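(* Let $G$ be a graphical cake represented by a finite connected graph of radius $r$, let two agents $A,B$ have valuations $v_A,v_B$ on $G$, and let $0\le t\le 1$ with entitlement vector $(t,1-t)$. Then there exists a weighted consensus division $(\alpha,\beta)$ of $G$ such that each of $\alpha$ and $\beta$ has at most $r+2$ connected components.
   Context: A graphical cake represented by a finite graph $G=(V,E)$ (loops and multiple edges allowed) consists of $|E|$ closed intervals, one per edge, with endpoints identified according to the incidence structure of $G$. A piece is a finite union of subintervals of edges; its connected pieces are its path components under the endpoint identifications. The radius of a connected graph is $\min_{v}\max_{w}d(v,w)$, with $d$ the graph distance. A valuation is a non-atomic Borel probability measure on the cake. A division between two agents is a pair of pieces $(\alpha,\beta)$ with $\alpha\cup\beta=G$ and $\alpha\cap\beta$ finite. Given entitlements $(t,1-t)$, $0\le t\le1$, a division is a weighted consensus division if $v_A(\alpha)=v_B(\alpha)=t$ and $v_A(\beta)=v_B(\beta)=1-t$. *)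

theory Defs
  imports "HOL-Analysis.Analysis" "HOL-Probability.Probability"
begin

text \<open>A graph is given by a vertex set V, an edge set E and an endpoint map
  ends :: edge => (vertex, vertex). Loops: ends e = (v,v). Multiple edges: distinct
  edge names with the same endpoints.\<close>

definition is_graph :: "'v set \<Rightarrow> 'e set \<Rightarrow> ('e \<Rightarrow> 'v \<times> 'v) \<Rightarrow> bool" where
  "is_graph V E ends \<longleftrightarrow> finite V \<and> finite E \<and>
     (\<forall>e\<in>E. fst (ends e) \<in> V \<and> snd (ends e) \<in> V)"

definition gadj :: "'e set \<Rightarrow> ('e \<Rightarrow> 'v \<times> 'v) \<Rightarrow> 'v \<Rightarrow> 'v \<Rightarrow> bool" where
  "gadj E ends u w \<longleftrightarrow> (\<exists>e\<in>E. ends e = (u, w) \<or> ends e = (w, u))"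

inductive walk :: "'v set \<Rightarrow> 'e set \<Rightarrow> ('e \<Rightarrow> 'v \<times> 'v) \<Rightarrow> nat \<Rightarrow> 'v \<Rightarrow> 'v \<Rightarrow> bool"
  for V E ends where
  walk0: "v \<in> V \<Longrightarrow> walk V E ends 0 v v"
| walkS: "gadj E ends u w \<Longrightarrow> walk V E ends n w x \<Longrightarrow> walk V E ends (Suc n) u x"

definition graph_connected :: "'v set \<Rightarrow> 'e set \<Rightarrow> ('e \<Rightarrow> 'v \<times> 'v) \<Rightarrow> bool" where
  "graph_connected V E ends \<longleftrightarrow> V \<noteq> {} \<and> (\<forall>u\<in>V. \<forall>w\<in>V. \<exists>n. walk V E ends n u w)"

definition gdist :: "'v set \<Rightarrow> 'e set \<Rightarrow> ('e \<Rightarrow> 'v \<times> 'v) \<Rightarrow> 'v \<Rightarrow> 'v \<Rightarrow> nat" where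
  "gdist V E ends u w = (LEAST n. walk V E ends n u w)"

definition graph_radius :: "'v set \<Rightarrow> 'e set \<Rightarrow> ('e \<Rightarrow> 'v \<times> 'v) \<Rightarrow> nat" where
  "graph_radius V E ends = Min ((\<lambda>v. Max ((\<lambda>w. gdist V E ends v w) ` V)) ` V)"

text \<open>Points of the cake: vertices, or interior points of edges (edge e, parameter x in (0,1)).\<close>
datatype ('v, 'e) cpt = Vx 'v | Ep 'e real

text \<open>Identification map from the disjoint union of the closed intervals [0,1] (one per edge):
  parameter 0 of edge e is the first endpoint of e, parameter 1 the second one.\<close>
definition cq :: "('e \<Rightarrow> 'v \<times> 'v) \<Rightarrow> 'e \<times> real \<Rightarrow> ('v, 'e) cpt" where
  "cq ends p = (if snd p = 0 then Vx (fst (ends (fst p)))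
               else if snd p = 1 then Vx (snd (ends (fst p)))
               else Ep (fst p) (snd p))"

definition cake_pts :: "'e set \<Rightarrow> ('e \<Rightarrow> 'v \<times> 'v) \<Rightarrow> ('v, 'e) cpt set" where
  "cake_pts E ends = cq ends ` (E \<times> {0..1})"

definition edges_top :: "'e set \<Rightarrow> ('e \<times> real) topology" where
  "edges_top E = prod_topology (discrete_topology E) (top_of_set {0..1})"

definition cake_top :: "'e set \<Rightarrow> ('e \<Rightarrow> 'v \<times> 'v) \<Rightarrow> ('v, 'e) cpt topology" where
  "cake_top E ends = topology (\<lambda>U. U \<subseteq> cake_pts E ends \<and>
      openin (edges_top E) {p \<in> topspace (edges_top E). cq ends p \<in> U})"

lemma istopology_cake: "istopology (\<lambda>U. U \<subseteq> cake_pts E ends \<and>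
      openin (edges_top E) {p \<in> topspace (edges_top E). cq ends p \<in> U})"
proof -
  have int: "{p \<in> topspace (edges_top E). cq ends p \<in> S \<inter> T} =
     {p \<in> topspace (edges_top E). cq ends p \<in> S} \<inter> {p \<in> topspace (edges_top E). cq ends p \<in> T}" for S T
    by auto
  have un: "{p \<in> topspace (edges_top E). cq ends p \<in> \<Union>K} =
     \<Union>((\<lambda>S. {p \<in> topspace (edges_top E). cq ends p \<in> S}) ` K)" for K
    by auto
  show ?thesis
    unfolding istopology_def
  proof (rule conjI; intro allI impI)
    fix S T assume "S \<subseteq> cake_pts E ends \<and> openin (edges_top E) {p \<in> topspace (edges_top E). cq ends p \<in> S}"
      "T \<subseteq> cake_pts E ends \<and> openin (edges_top E) {p \<in> topspace (edges_top E). cq ends p \<in> T}"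
    then show "S \<inter> T \<subseteq> cake_pts E ends \<and> openin (edges_top E) {p \<in> topspace (edges_top E). cq ends p \<in> S \<inter> T}"
      unfolding int by (auto intro: openin_Int)
  next
    fix K assume K: "\<forall>S\<in>K. S \<subseteq> cake_pts E ends \<and> openin (edges_top E) {p \<in> topspace (edges_top E). cq ends p \<in> S}"
    then show "\<Union>K \<subseteq> cake_pts E ends \<and> openin (edges_top E) {p \<in> topspace (edges_top E). cq ends p \<in> \<Union>K}"
      unfolding un by (auto intro!: openin_Union)
  qed
qed

definition is_piece :: "'e set \<Rightarrow> ('e \<Rightarrow> 'v \<times> 'v) \<Rightarrow> ('v, 'e) cpt set \<Rightarrow> bool" where
  "is_piece E ends S \<longleftrightarrow> (\<exists>F. finite F \<and>
      (\<forall>(e, I)\<in>F. e \<in> E \<and> is_interval I \<and> I \<subseteq> {0..1}) \<and>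
      S = (\<Union>(e, I)\<in>F. cq ends ` ({e} \<times> I)))"

definition n_components :: "'e set \<Rightarrow> ('e \<Rightarrow> 'v \<times> 'v) \<Rightarrow> ('v, 'e) cpt set \<Rightarrow> nat" where
  "n_components E ends S = card (path_components_of (subtopology (cake_top E ends) S))"

definition finite_components :: "'e set \<Rightarrow> ('e \<Rightarrow> 'v \<times> 'v) \<Rightarrow> ('v, 'e) cpt set \<Rightarrow> bool" where
  "finite_components E ends S \<longleftrightarrow> finite (path_components_of (subtopology (cake_top E ends) S))"

definition cake_borel :: "'e set \<Rightarrow> ('e \<Rightarrow> 'v \<times> 'v) \<Rightarrow> ('v, 'e) cpt measure" where
  "cake_borel E ends = sigma (topspace (cake_top E ends)) {U. openin (cake_top E ends) U}"

definition is_valuation :: "'e set \<Rightarrow> ('e \<Rightarrow> 'v \<times> 'v) \<Rightarrow> ('v, 'e) cpt measure \<Rightarrow> bool" where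
  "is_valuation E ends \<mu> \<longleftrightarrow> prob_space \<mu> \<and> sets \<mu> = sets (cake_borel E ends) \<and>
      (\<forall>x. emeasure \<mu> {x} = 0)"

definition is_division :: "'e set \<Rightarrow> ('e \<Rightarrow> 'v \<times> 'v) \<Rightarrow> ('v, 'e) cpt set \<Rightarrow> ('v, 'e) cpt set \<Rightarrow> bool" where
  "is_division E ends \<alpha> \<beta> \<longleftrightarrow> is_piece E ends \<alpha> \<and> is_piece E ends \<beta> \<and>
      \<alpha> \<union> \<beta> = cake_pts E ends \<and> finite (\<alpha> \<inter> \<beta>)"

definition weighted_consensus :: "('v, 'e) cpt measure \<Rightarrow> ('v, 'e) cpt measure \<Rightarrow> real \<Rightarrow>
    ('v, 'e) cpt set \<Rightarrow> ('v, 'e) cpt set \<Rightarrow> bool" where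
  "weighted_consensus vA vB t \<alpha> \<beta> \<longleftrightarrow>
     measure vA \<alpha> = t \<and> measure vB \<alpha> = t \<and> measure vA \<beta> = 1 - t \<and> measure vB \<beta> = 1 - t"

end

theory Submission
  imports Defs
begin

text \<open>Take a breadth-first tree rooted at a centre \<open>c\<close> of the graph and hang every remaining edge
  at one of its endpoints; this is a tree of depth at most \<open>r + 1\<close> (in edges) covering the cake.
  Traversing it depth first lays the cake out along a line. The image of an initial interval is
  connected and contains \<open>c\<close>. The image of an arbitrary interval \<open>[p, q]\<close> splits into at most one
  connected part below each vertex on the path from \<open>c\<close> to the point at \<open>p\<close>, plus the rest of the
  edge containing that point, so together with \<open>c\<close> it needs at most \<open>r + 2\<close> connected sets. The
  complementary piece is the image of an initial and a final interval, which both contain \<open>c\<close>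
  after adding this single point, so it needs at most \<open>r + 2\<close> connected sets as well. It remains to
  find an interval to which both agents give \<open>t\<close>, or both give \<open>1 - t\<close>; this is the intermediate
  value theorem on the circle obtained by joining the ends of the line.\<close>

section \<open>Topology of the cake\<close>

lemma topspace_edges_top [simp]: "topspace (edges_top E) = E \<times> {0..1}"
  by (simp add: edges_top_def)

lemma openin_cake_top:
  "openin (cake_top E ends) U \<longleftrightarrow> U \<subseteq> cake_pts E ends \<and>
     openin (edges_top E) {p \<in> E \<times> {0..1}. cq ends p \<in> U}"
  unfolding cake_top_def topology_inverse'[OF istopology_cake] by simp

lemma topspace_cake_top [simp]: "topspace (cake_top E ends) = cake_pts E ends"
proof (rule subset_antisym)
  show "topspace (cake_top E ends) \<subseteq> cake_pts E ends"
    using openin_cake_top[of E ends "topspace (cake_top E ends)"] by simp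
  have "{p \<in> E \<times> {0..1}. cq ends p \<in> cake_pts E ends} = topspace (edges_top E)"
    by (auto simp: cake_pts_def)
  then have "openin (cake_top E ends) (cake_pts E ends)"
    unfolding openin_cake_top by (metis openin_topspace subset_refl)
  then show "cake_pts E ends \<subseteq> topspace (cake_top E ends)"
    by (rule openin_subset)
qed

lemma continuous_map_cq: "continuous_map (edges_top E) (cake_top E ends) (cq ends)"
  unfolding continuous_map_def
  by (auto simp: openin_cake_top cake_pts_def)

lemma path_connectedin_edge:
  assumes "e \<in> E" "0 \<le> a" "b \<le> 1"
  shows "path_connectedin (cake_top E ends) ((\<lambda>x. cq ends (e, x)) ` {a..b})"
proof -
  have "path_connectedin (edges_top E) ({e} \<times> {a..b})"
    using assms unfolding edges_top_def path_connectedin_Times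
    by (auto simp: path_connectedin_subtopology path_connectedin_euclidean)
  from path_connectedin_continuous_map_image[OF continuous_map_cq this]
  have "path_connectedin (cake_top E ends) (cq ends ` ({e} \<times> {a..b}))" .
  moreover have "cq ends ` ({e} \<times> {a..b}) = (\<lambda>x. cq ends (e, x)) ` {a..b}" by auto
  ultimately show ?thesis by simp
qed

section \<open>Edges laid out along a line\<close>

definition orient :: "bool \<Rightarrow> real \<Rightarrow> real" where
  "orient b x = (if b then x else 1 - x)"

text \<open>The flag lets each edge be traversed away from the root: with the flag as in
  \<open>dfs_edge\<close>, parameter 0 is the parent and parameter 1 the child.\<close>

definition edge_pt :: "('e \<Rightarrow> 'v \<times> 'v) \<Rightarrow> 'e \<times> bool \<Rightarrow> real \<Rightarrow> ('v, 'e) cpt" where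
  "edge_pt ends a x = cq ends (fst a, orient (snd a) x)"

lemma orient_image: "orient b ` {p..q} = (if b then {p..q} else {1 - q..1 - p})"
  by (auto simp: orient_def[abs_def])

lemma edge_pt_image: "edge_pt ends a ` S = (\<lambda>x. cq ends (fst a, x)) ` (orient (snd a) ` S)"
  by (auto simp: edge_pt_def)

lemma path_connectedin_edge_pt:
  assumes "fst a \<in> E" "0 \<le> p" "q \<le> 1"
  shows "path_connectedin (cake_top E ends) (edge_pt ends a ` {p..q})"
  unfolding edge_pt_image orient_image using assms by (auto intro!: path_connectedin_edge)

lemma edge_pt_ends:
  assumes "ends e = (if b then (v, w) else (w, v))"
  shows "edge_pt ends (e, b) 0 = Vx v" "edge_pt ends (e, b) 1 = Vx w"
  using assms by (auto simp: edge_pt_def cq_def orient_def)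

text \<open>A list of oriented edges lays the cake out along a line, its \<open>i\<close>-th edge (counting from \<open>0\<close>) on
  the interval from \<open>i\<close> to \<open>i + 1\<close>; \<open>seg\<close> is the part laid out between \<open>p\<close> and \<open>q\<close>.\<close>

primrec seg :: "('e \<Rightarrow> 'v \<times> 'v) \<Rightarrow> ('e \<times> bool) list \<Rightarrow> real \<Rightarrow> real \<Rightarrow> ('v, 'e) cpt set" where
  "seg ends [] p q = {}"
| "seg ends (a # L) p q = edge_pt ends a ` {max 0 p..min 1 q} \<union> seg ends L (p - 1) (q - 1)"

lemma seg_append:
  "seg ends (L @ M) p q = seg ends L p q \<union> seg ends M (p - real (length L)) (q - real (length L))"
proof (induction L arbitrary: p q)
  case (Cons a L)
  have "p - 1 - real (length L) = p - real (length (a # L))"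
    "q - 1 - real (length L) = q - real (length (a # L))" by auto
  then show ?case by (simp only: append_Cons seg.simps Cons.IH Un_assoc)
qed simp

lemma seg_neg: "q < 0 \<Longrightarrow> seg ends L p q = {}"
  by (induction L arbitrary: p q) auto

lemma seg_beyond: "real (length L) < p \<Longrightarrow> seg ends L p q = {}"
  by (induction L arbitrary: p q) auto

lemma seg_Un: "p \<le> q \<Longrightarrow> q \<le> s \<Longrightarrow> seg ends L p q \<union> seg ends L q s = seg ends L p s"
proof (induction L arbitrary: p q s)
  case (Cons a L)
  have "{max 0 p..min 1 q} \<union> {max 0 q..min 1 s} = {max 0 p..min 1 s}"
    using Cons.prems by (auto simp: max_def min_def)
  then have "edge_pt ends a ` {max 0 p..min 1 q} \<union> edge_pt ends a ` {max 0 q..min 1 s}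
     = edge_pt ends a ` {max 0 p..min 1 s}" by (metis image_Un)
  moreover have "seg ends L (p - 1) (q - 1) \<union> seg ends L (q - 1) (s - 1) = seg ends L (p - 1) (s - 1)"
    using Cons by simp
  ultimately show ?case unfolding seg.simps by blast
qed simp

lemma seg_full:
  "p \<le> 0 \<Longrightarrow> real (length L) \<le> q \<Longrightarrow> seg ends L p q = cake_pts (fst ` set L) ends"
proof (induction L arbitrary: p q)
  case (Cons a L)
  have "{max 0 p..min 1 q} = {0..1}" using Cons.prems by auto
  then have "edge_pt ends a ` {max 0 p..min 1 q} = cq ends ` ({fst a} \<times> {0..1})"
    unfolding edge_pt_image by (force simp: orient_image)
  moreover have "seg ends L (p - 1) (q - 1) = cake_pts (fst ` set L) ends"
    using Cons by simp
  moreover have "fst ` set (a # L) \<times> {0..1::real} = {fst a} \<times> {0..1} \<union> fst ` set L \<times> {0..1}"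
    by auto
  ultimately show ?case unfolding seg.simps cake_pts_def by (simp only: image_Un)
qed (simp add: cake_pts_def)

section \<open>Pieces\<close>

lemma is_piece_Un: "is_piece E ends S \<Longrightarrow> is_piece E ends T \<Longrightarrow> is_piece E ends (S \<union> T)"
  unfolding is_piece_def
  apply (elim exE conjE)
  subgoal for F G by (rule exI[of _ "F \<union> G"]) auto
  done

lemma is_piece_empty: "is_piece E ends {}"
  unfolding is_piece_def by (rule exI[of _ "{}"]) auto

lemma is_piece_edge_pt:
  assumes "fst a \<in> E" "0 \<le> p" "q \<le> 1"
  shows "is_piece E ends (edge_pt ends a ` {p..q})"
  unfolding is_piece_def edge_pt_image
  using assms
  by (intro exI[of _ "{(fst a, orient (snd a) ` {p..q})}"])
    (auto simp: orient_image)

lemma is_piece_singleton: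
  assumes "x \<in> cake_pts E ends"
  shows "is_piece E ends {x}"
proof -
  from assms obtain e y where "e \<in> E" "0 \<le> y" "y \<le> 1" "x = cq ends (e, y)"
    by (auto simp: cake_pts_def)
  then show ?thesis
    using is_piece_edge_pt[of "(e, True)" E y y ends] by (simp add: edge_pt_def orient_def)
qed

lemma is_piece_finite: "finite S \<Longrightarrow> S \<subseteq> cake_pts E ends \<Longrightarrow> is_piece E ends S"
proof (induction S rule: finite_induct)
  case (insert x S)
  then have "is_piece E ends ({x} \<union> S)" by (intro is_piece_Un is_piece_singleton) auto
  then show ?case by simp
qed (rule is_piece_empty)

lemma is_piece_seg: "fst ` set L \<subseteq> E \<Longrightarrow> is_piece E ends (seg ends L p q)"
  by (induction L arbitrary: p q) (auto intro!: is_piece_Un is_piece_empty is_piece_edge_pt)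

section \<open>Covering by connected sets\<close>

text \<open>The slack set \<open>W\<close> absorbs isolated vertices: they are null sets, so a piece may contain them
  whenever this helps to join it up.\<close>

definition covered :: "'a topology \<Rightarrow> nat \<Rightarrow> 'a set \<Rightarrow> 'a \<Rightarrow> 'a set \<Rightarrow> bool" where
  "covered X k W x S \<longleftrightarrow> (\<exists>C. finite C \<and> card C \<le> k \<and> (\<forall>K\<in>C. path_connectedin X K) \<and>
     x \<in> \<Union>C \<and> S \<subseteq> \<Union>C \<and> \<Union>C \<subseteq> S \<union> W)"

lemma covered_single:
  assumes "path_connectedin X K" "x \<in> K" "S \<subseteq> K" "K \<subseteq> S \<union> W" "1 \<le> k"
  shows "covered X k W x S"
  unfolding covered_def using assms by (intro exI[of _ "{K}"]) auto

text \<open>One further set allows a change of base point: \<open>y\<close> is forgotten and the new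
  set carries \<open>x\<close>. This is the cost of passing from a child to its parent.\<close>

lemma covered_add:
  assumes "covered X k W y S" "path_connectedin X K" "x \<in> K" "T \<subseteq> K" "K \<subseteq> T \<union> W"
  shows "covered X (Suc k) W x (S \<union> T)"
proof -
  from assms(1) obtain C where C: "finite C" "card C \<le> k" "\<forall>K\<in>C. path_connectedin X K"
    "S \<subseteq> \<Union>C" "\<Union>C \<subseteq> S \<union> W" unfolding covered_def by blast
  have "card (insert K C) \<le> Suc k" using C(1,2) by (simp add: card_insert_if)
  then show ?thesis
    unfolding covered_def using C assms(2-) by (intro exI[of _ "insert K C"]) auto
qed

text \<open>The member of the family that contains \<open>x\<close> is enlarged by \<open>K\<close>,
  which meets it in \<open>x\<close>, so the number of sets does not grow.\<close>

lemma covered_merge: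
  assumes "covered X k W x S" "path_connectedin X K" "x \<in> K" "T \<subseteq> K" "K \<subseteq> T \<union> W"
  shows "covered X k W x (S \<union> T)"
proof -
  from assms(1) obtain C where C: "finite C" "card C \<le> k" "\<forall>K\<in>C. path_connectedin X K"
    "x \<in> \<Union>C" "S \<subseteq> \<Union>C" "\<Union>C \<subseteq> S \<union> W" unfolding covered_def by blast
  then obtain M where M: "M \<in> C" "x \<in> M" by blast
  let ?D = "insert (M \<union> K) (C - {M})"
  have "0 < card C" using C(1) M(1) card_gt_0_iff by blast
  then have "card ?D \<le> k"
    using C(1,2) M(1) by (auto simp: card_insert_if card_Diff_singleton)
  moreover have "path_connectedin X (M \<union> K)"
    using C(3) M assms(2,3) by (intro path_connectedin_Un) auto
  moreover have "\<Union>?D = \<Union>C \<union> K" using M by auto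
  ultimately show ?thesis
    unfolding covered_def using C assms(3-) by (intro exI[of _ ?D]) auto
qed

text \<open>A path component absorbs every member of \<open>C\<close> that it meets. Choosing one
  nonempty member inside each component is injective, as distinct components are disjoint.\<close>

lemma path_components_of_Union_bound:
  assumes "finite C" "\<And>K. K \<in> C \<Longrightarrow> path_connectedin X K"
  shows "finite (path_components_of (subtopology X (\<Union>C)))"
    and "card (path_components_of (subtopology X (\<Union>C))) \<le> card C"
proof -
  let ?Y = "subtopology X (\<Union>C)"
  have "\<exists>K\<in>C. K \<noteq> {} \<and> K \<subseteq> P" if P: "P \<in> path_components_of ?Y" for P
  proof -
    obtain x where "x \<in> P" using nonempty_path_components_of[OF P] by blast
    moreover then obtain K where K: "K \<in> C" "x \<in> K"
      using path_components_of_subset[OF P] by auto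
    moreover have "path_connectedin ?Y K"
      using K(1) assms(2) by (auto simp: path_connectedin_subtopology)
    ultimately have "K \<subseteq> P" using path_components_of_maximal[OF P] by (auto simp: disjnt_def)
    with K show ?thesis by blast
  qed
  then obtain g where g: "\<And>P. P \<in> path_components_of ?Y \<Longrightarrow> g P \<in> C \<and> g P \<noteq> {} \<and> g P \<subseteq> P"
    by metis
  have "inj_on g (path_components_of ?Y)"
  proof (rule inj_onI)
    fix P Q assume "P \<in> path_components_of ?Y" "Q \<in> path_components_of ?Y" "g P = g Q"
    moreover then have "P \<inter> Q \<noteq> {}" using g[of P] g[of Q] by auto
    ultimately show "P = Q" using path_components_of_overlap by blast
  qed
  moreover have "g ` path_components_of ?Y \<subseteq> C" using g by auto
  ultimately show "finite (path_components_of ?Y)" "card (path_components_of ?Y) \<le> card C"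
    using assms(1) by (auto intro: inj_on_finite card_inj_on_le)
qed

text \<open>In \<open>dfs_layout E ends d v L U\<close>, the set \<open>U\<close> records which vertices can still carry a subtree and
  of which depth. Vertices may repeat: an edge closing a cycle hangs at one endpoint only, its
  other end being treated as a new leaf.\<close>

inductive dfs_layout :: "'e set \<Rightarrow> ('e \<Rightarrow> 'v \<times> 'v) \<Rightarrow> nat \<Rightarrow> 'v \<Rightarrow> ('e \<times> bool) list \<Rightarrow> ('v \<times> nat) set \<Rightarrow> bool"
  for E ends where
  dfs_nil: "dfs_layout E ends d v [] {(v, d)}"
| dfs_edge: "e \<in> E \<Longrightarrow> ends e = (if b then (v, w) else (w, v)) \<Longrightarrow>
    dfs_layout E ends d w L1 U1 \<Longrightarrow> dfs_layout E ends (Suc d) v L2 U2 \<Longrightarrow>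
    dfs_layout E ends (Suc d) v ((e, b) # L1 @ L2) (U1 \<union> U2)"

lemma edge_pt_in_cake:
  assumes "fst a \<in> E" "0 \<le> x" "x \<le> 1"
  shows "edge_pt ends a x \<in> cake_pts E ends"
  using assms by (auto simp: edge_pt_def cake_pts_def orient_def intro!: imageI)

lemma Un_insert_absorb:
  "y \<in> A \<Longrightarrow> A \<union> insert y B \<union> insert x C = insert x (A \<union> (B \<union> C))"
  by blast

text \<open>A subtree is entered only after the edge leading to it is completed, so the part
  traversed stays joined to the root. Inserting the root covers \<open>q < 0\<close>, where the
  segment is empty.\<close>

lemma path_connected_initial_seg:
  assumes "dfs_layout E ends d v L U" "Vx v \<in> cake_pts E ends" "p \<le> 0"
  shows "path_connectedin (cake_top E ends) (insert (Vx v) (seg ends L p q))"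
  using assms
proof (induction arbitrary: p q rule: dfs_layout.induct)
  case (dfs_nil d v)
  then show ?case by simp
next
  case (dfs_edge e b v w d L1 U1 L2 U2)
  note ends = edge_pt_ends[where ends=ends and e=e and b=b and v=v and w=w, OF dfs_edge.hyps(2)]
  let ?X = "cake_top E ends" and ?l = "real (length L1)"
  let ?e = "edge_pt ends (e, b) ` {max 0 p..min 1 q}"
  have w: "Vx w \<in> cake_pts E ends"
    using edge_pt_in_cake[of "(e, b)" E 1 ends] dfs_edge.hyps(1) ends by simp
  have pe: "path_connectedin ?X ?e"
    using dfs_edge.hyps(1) by (intro path_connectedin_edge_pt) auto
  have v_e: "Vx v \<in> ?e" if "0 \<le> q"
    using that \<open>p \<le> 0\<close> ends(1) by (auto simp: image_iff intro!: bexI[of _ 0])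
  show ?case
  proof (cases "q < 1")
    case True
    then have *: "seg ends ((e, b) # L1 @ L2) p q = ?e" by (simp add: seg_append seg_neg)
    show ?thesis
    proof (cases "q < 0")
      case True then show ?thesis using dfs_edge.prems by (simp add: seg_append seg_neg)
    next
      case False
      with v_e pe show ?thesis unfolding * by (simp add: insert_absorb)
    qed
  next
    case False
    have w_e: "Vx w \<in> ?e"
      using False \<open>p \<le> 0\<close> ends(2) by (auto simp: image_iff intro!: bexI[of _ 1])
    \<comment> \<open>The part below \<open>w\<close> is joined to the edge at \<open>w\<close>, and
      the later branches at \<open>v\<close>.\<close>
    let ?S1 = "insert (Vx w) (seg ends L1 (p - 1) (q - 1))"
    let ?S2 = "insert (Vx v) (seg ends L2 (p - 1 - ?l) (q - 1 - ?l))"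
    have "path_connectedin ?X ?S1" using dfs_edge.IH(1)[OF w] dfs_edge.prems by simp
    moreover have "?e \<inter> ?S1 \<noteq> {}" using w_e by (metis IntI empty_iff insertI1)
    ultimately have 1: "path_connectedin ?X (?e \<union> ?S1)"
      by (rule path_connectedin_Un[OF pe])
    have 2: "path_connectedin ?X ?S2" using dfs_edge.IH(2) dfs_edge.prems by simp
    have "Vx v \<in> (?e \<union> ?S1) \<inter> ?S2" using v_e False by simp
    then have "(?e \<union> ?S1) \<inter> ?S2 \<noteq> {}" by (metis empty_iff)
    then have "path_connectedin ?X (?e \<union> ?S1 \<union> ?S2)"
      by (rule path_connectedin_Un[OF 1 2])
    have "?e \<union> ?S1 \<union> ?S2 = insert (Vx v) (seg ends ((e, b) # L1 @ L2) p q)"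
      unfolding seg.simps seg_append append_Cons using w_e by (rule Un_insert_absorb)
    with \<open>path_connectedin ?X (?e \<union> ?S1 \<union> ?S2)\<close> show ?thesis by simp
  qed
qed

text \<open>The place of the left end \<open>p\<close> decides. On or before the first edge, two
  sets suffice: this edge with the subtree below it, and the later branches joined at
  \<open>v\<close>. Within \<open>L1\<close>, the bound \<open>Suc d\<close> grows by one set for
  the later branches. Beyond \<open>L1\<close>, only \<open>L2\<close> counts, at the same
  depth.\<close>

lemma covered_seg:
  assumes "dfs_layout E ends d v L U" "Vx v \<in> cake_pts E ends" "Vx v \<in> W"
    "\<And>e. e \<in> E \<Longrightarrow> Vx (fst (ends e)) \<in> W \<and> Vx (snd (ends e)) \<in> W"
  shows "covered (cake_top E ends) (Suc d) W (Vx v) (seg ends L p q)"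
  using assms(1-3)
proof (induction arbitrary: p q rule: dfs_layout.induct)
  case (dfs_nil d v)
  then show ?case by (intro covered_single[of _ "{Vx v}"]) auto
next
  case (dfs_edge e b v w d L1 U1 L2 U2)
  note ends = edge_pt_ends[where ends=ends and e=e and b=b and v=v and w=w, OF dfs_edge.hyps(2)]
  let ?X = "cake_top E ends" and ?l = "real (length L1)"
  let ?e = "edge_pt ends (e, b) ` {max 0 p..min 1 q}"
  let ?s1 = "seg ends L1 (p - 1) (q - 1)" and ?s2 = "seg ends L2 (p - 1 - ?l) (q - 1 - ?l)"
  have w: "Vx w \<in> cake_pts E ends"
    using edge_pt_in_cake[of "(e, b)" E 1 ends] dfs_edge.hyps(1) ends by simp
  have wW: "Vx w \<in> W"
    using assms(4)[OF dfs_edge.hyps(1)] dfs_edge.hyps(2) by (auto split: if_splits)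
  have pe: "path_connectedin ?X ?e"
    using dfs_edge.hyps(1) by (intro path_connectedin_edge_pt) auto
  have eq: "seg ends ((e, b) # L1 @ L2) p q = ?e \<union> ?s1 \<union> ?s2"
    by (simp only: seg.simps seg_append append_Cons Un_assoc)
  have p2: "path_connectedin ?X (insert (Vx v) ?s2)" if "p \<le> 1 + ?l"
    using path_connected_initial_seg[OF dfs_edge.hyps(4)] dfs_edge.prems that by auto
  show ?case
  proof (cases "p \<le> 1")
    case True
    \<comment> \<open>An interval that stops before \<open>w\<close> leaves only a part of the edge;
      otherwise \<open>w\<close> links the edge to its subtree.\<close>
    have "\<exists>K. path_connectedin ?X K \<and> ?e \<union> ?s1 \<subseteq> K \<and> K \<subseteq> ?e \<union> ?s1 \<union> W"
    proof (cases "q < 1")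
      case True
      with pe show ?thesis by (intro exI[of _ ?e]) (simp add: seg_neg)
    next
      case False
      have we: "Vx w \<in> ?e"
        using False \<open>p \<le> 1\<close> ends(2) by (auto simp: image_iff intro!: bexI[of _ 1])
      have 1: "path_connectedin ?X (insert (Vx w) ?s1)"
        using path_connected_initial_seg[OF dfs_edge.hyps(3) w] True by simp
      have "?e \<inter> insert (Vx w) ?s1 \<noteq> {}"
        using we by (metis IntI empty_iff insertI1)
      then have "path_connectedin ?X (?e \<union> insert (Vx w) ?s1)"
        by (rule path_connectedin_Un[OF pe 1])
      then show ?thesis using wW by (intro exI[of _ "?e \<union> insert (Vx w) ?s1"]) blast
    qed
    then obtain K where K: "path_connectedin ?X K" "?e \<union> ?s1 \<subseteq> K" "K \<subseteq> ?e \<union> ?s1 \<union> W" by blast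
    \<comment> \<open>\<open>covered\<close> asks for a base point, which an empty \<open>K\<close>
      cannot supply.\<close>
    show ?thesis
    proof (cases "K = {}")
      case True
      with K(2) have "?e = {}" "?s1 = {}" by auto
      then show ?thesis unfolding eq using dfs_edge.prems p2 \<open>p \<le> 1\<close>
        by (intro covered_single[of _ "insert (Vx v) ?s2"]) auto
    next
      case False
      then obtain y where "y \<in> K" by auto
      then have "covered ?X (Suc d) W y (?e \<union> ?s1)"
        using K by (intro covered_single[of _ K]) simp_all
      then show ?thesis unfolding eq
        by (rule covered_add[OF _ p2]) (use \<open>p \<le> 1\<close> dfs_edge.prems in auto)
    qed
  next
    case False
    then have e: "?e = {}" by simp
    show ?thesis
    proof (cases "p \<le> 1 + ?l")
      case True
      show ?thesis unfolding eq e Un_empty_left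
        by (rule covered_add[OF dfs_edge.IH(1)[OF w wW] p2]) (use True dfs_edge.prems in auto)
    next
      case False
      then have "?s1 = {}" by (intro seg_beyond) auto
      then show ?thesis unfolding eq e using dfs_edge.IH(2) dfs_edge.prems by simp
    qed
  qed
qed

section \<open>Layouts of graphs of given radius\<close>

lemma gadj_in_V: "is_graph V E ends \<Longrightarrow> gadj E ends u w \<Longrightarrow> u \<in> V \<and> w \<in> V"
  unfolding is_graph_def gadj_def by force

text \<open>Walks are built from their first step, but distances from the centre require splitting
  off the last one.\<close>

lemma walk_SucE:
  assumes "walk V E ends (Suc n) u x" "is_graph V E ends"
  shows "\<exists>y. walk V E ends n u y \<and> gadj E ends y x"
  using assms
proof (induction n arbitrary: u)
  case 0
  then obtain w where "gadj E ends u w" "walk V E ends 0 w x" by (auto elim: walk.cases)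
  moreover from this(2) have "w = x" by (auto elim: walk.cases)
  ultimately show ?case using gadj_in_V[OF 0(2)] by (auto intro: walk0)
next
  case (Suc n)
  from Suc.prems(1) obtain w where "gadj E ends u w" "walk V E ends (Suc n) w x"
    by (auto elim: walk.cases)
  with Suc.IH[OF _ Suc.prems(2)] show ?case by (blast intro: walkS)
qed

lemma gdist_predecessor:
  assumes G: "is_graph V E ends" "graph_connected V E ends" and "c \<in> V" "w \<in> V" "w \<noteq> c"
  obtains u where "u \<in> V" "gadj E ends u w" "gdist V E ends c u < gdist V E ends c w"
proof -
  have "\<exists>n. walk V E ends n c w" using assms by (auto simp: graph_connected_def)
  then have walk: "walk V E ends (gdist V E ends c w) c w" unfolding gdist_def by (rule LeastI_ex)
  moreover have "gdist V E ends c w \<noteq> 0" using walk \<open>w \<noteq> c\<close> by (auto elim: walk.cases)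
  ultimately obtain n where n: "gdist V E ends c w = Suc n" "walk V E ends (Suc n) c w"
    using not0_implies_Suc by metis
  from walk_SucE[OF n(2) G(1)] obtain u where u: "walk V E ends n c u" "gadj E ends u w" by blast
  have "gdist V E ends c u \<le> n" unfolding gdist_def using u(1) by (rule Least_le)
  with u n gadj_in_V[OF G(1) u(2)] show thesis by (intro that[of u]) auto
qed

lemma graph_centre:
  assumes "is_graph V E ends" "graph_connected V E ends"
  obtains c where "c \<in> V" "\<And>w. w \<in> V \<Longrightarrow> gdist V E ends c w \<le> graph_radius V E ends"
proof -
  have V: "finite V" "V \<noteq> {}" using assms by (auto simp: is_graph_def graph_connected_def)
  then have "graph_radius V E ends \<in> (\<lambda>v. Max ((\<lambda>w. gdist V E ends v w) ` V)) ` V"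
    unfolding graph_radius_def by (intro Min_in) auto
  then obtain c where "c \<in> V" "graph_radius V E ends = Max (gdist V E ends c ` V)" by auto
  with V show thesis by (intro that[of c]) auto
qed

section \<open>Growing layouts edge by edge\<close>

lemma dfs_layout_edges: "dfs_layout E ends d v L U \<Longrightarrow> fst ` set L \<subseteq> E"
  by (induction rule: dfs_layout.induct) auto

text \<open>Points come from edges only, so a graph without edges has an empty cake even if it has
  vertices.\<close>

lemma dfs_layout_root_in_cake:
  assumes "dfs_layout E ends d v L U" "L \<noteq> []"
  shows "Vx v \<in> cake_pts E ends"
  using assms
proof (cases rule: dfs_layout.cases)
  case (dfs_edge e b w d L1 U1 L2 U2)
  then show ?thesis
    using edge_pt_in_cake[of "(e, b)" E 0 ends] edge_pt_ends(1)[of ends e b v w] by simp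
qed simp

text \<open>An entry of \<open>U\<close> stands for a \<open>dfs_nil\<close> that ends the branches
  at an occurrence of \<open>u\<close>. It is replaced by the new edge with two empty lists. The
  entry survives, so more edges can hang there. The edge may land inside the list, hence the
  multisets.\<close>

lemma dfs_layout_insert:
  assumes "dfs_layout E ends d v L U" "(u, Suc k) \<in> U" "e \<in> E"
    "ends e = (if b then (u, w) else (w, u))"
  shows "\<exists>L' U'. dfs_layout E ends d v L' U' \<and>
    mset (map fst L') = mset (e # map fst L) \<and> insert (w, k) U \<subseteq> U'"
  using assms(1,2)
proof (induction rule: dfs_layout.induct)
  case (dfs_nil d v)
  then have v: "v = u" "d = Suc k" by auto
  have "dfs_layout E ends d v ((e, b) # [] @ []) ({(w, k)} \<union> {(u, Suc k)})"
    unfolding v by (rule dfs_layout.dfs_edge[where w = w, OF assms(3)])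
      (use assms(4) in \<open>auto intro: dfs_layout.dfs_nil\<close>)
  with dfs_nil show ?case
    by (intro exI[of _ "(e, b) # [] @ []"] exI[of _ "{(w, k)} \<union> {(u, Suc k)}"]) auto
next
  case (dfs_edge e' b' v x d L1 U1 L2 U2)
  from dfs_edge.prems consider "(u, Suc k) \<in> U1" | "(u, Suc k) \<in> U2" by blast
  then show ?case
  proof cases
    case 1
    from dfs_edge.IH(1)[OF this] obtain L' U' where L': "dfs_layout E ends d x L' U'"
      "mset (map fst L') = mset (e # map fst L1)" "insert (w, k) U1 \<subseteq> U'" by blast
    with dfs_layout.dfs_edge[OF dfs_edge.hyps(1,2) L'(1) dfs_edge.hyps(4)] show ?thesis
      by (intro exI[of _ "(e', b') # L' @ L2"] exI[of _ "U' \<union> U2"]) auto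
  next
    case 2
    from dfs_edge.IH(2)[OF this] obtain L' U' where L': "dfs_layout E ends (Suc d) v L' U'"
      "mset (map fst L') = mset (e # map fst L2)" "insert (w, k) U2 \<subseteq> U'" by blast
    with dfs_layout.dfs_edge[OF dfs_edge.hyps(1,2,3) L'(1)] show ?thesis
      by (intro exI[of _ "(e', b') # L1 @ L'"] exI[of _ "U1 \<union> U'"]) auto
  qed
qed

lemma dfs_layout_insert_distinct:
  assumes "dfs_layout E ends d v L U" "distinct (map fst L)" "(u, Suc k) \<in> U"
    "e \<in> E - fst ` set L" "ends e = (u, w) \<or> ends e = (w, u)"
  obtains L' U' where "dfs_layout E ends d v L' U'" "distinct (map fst L')"
    "fst ` set L' = insert e (fst ` set L)" "insert (w, k) U \<subseteq> U'"
proof -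
  have "\<exists>b. ends e = (if b then (u, w) else (w, u))" using assms(5) by (metis (full_types))
  then obtain b where "ends e = (if b then (u, w) else (w, u))" ..
  with dfs_layout_insert[OF assms(1,3)] assms(4) obtain L' U' where L': "dfs_layout E ends d v L' U'"
    "mset (map fst L') = mset (e # map fst L)" "insert (w, k) U \<subseteq> U'" by blast
  have "set (map fst L') = set (e # map fst L)" using L'(2) by (rule mset_eq_setD)
  moreover have "distinct (map fst L') = distinct (e # map fst L)"
    using L'(2) by (rule mset_eq_imp_distinct_iff)
  ultimately show thesis using L' assms(2,4) by (intro that[of L' U']) auto
qed

text \<open>Vertices are attached in order of increasing distance from the centre. This keeps the
  remaining depth at a vertex at distance \<open>n\<close> at least \<open>Suc r - n\<close>, so that every vertex can still
  carry one further edge.\<close>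

lemma breadth_first_layout:
  assumes G: "is_graph V E ends" "graph_connected V E ends"
    and c: "c \<in> V" "\<And>w. w \<in> V \<Longrightarrow> gdist V E ends c w \<le> r"
    and W: "c \<in> W" "W \<subseteq> V" "dfs_layout E ends (Suc r) c L U" "distinct (map fst L)"
      "\<And>e. e \<in> fst ` set L \<Longrightarrow> fst (ends e) \<in> W \<and> snd (ends e) \<in> W"
      "\<And>x. x \<in> W \<Longrightarrow> \<exists>k. (x, k) \<in> U \<and> Suc r \<le> k + gdist V E ends c x"
  shows "\<exists>L U. dfs_layout E ends (Suc r) c L U \<and> distinct (map fst L) \<and> (\<forall>x\<in>V. \<exists>k. (x, Suc k) \<in> U)"
  using W
proof (induction "card (V - W)" arbitrary: W L U rule: less_induct)
  case less
  show ?case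
  proof (cases "W = V")
    case True
    have "\<exists>k. (x, Suc k) \<in> U" if "x \<in> V" for x
    proof -
      from less.prems(6)[of x] that True obtain k where "(x, k) \<in> U" "Suc r \<le> k + gdist V E ends c x"
        by blast
      moreover with c(2)[OF that] have "k = Suc (k - 1)" by simp
      ultimately show ?thesis by metis
    qed
    with less.prems show ?thesis by blast
  next
    case False
    obtain w0 where "w0 \<in> V - W" using False less.prems(2) by blast
    \<comment> \<open>A nearest vertex outside \<open>W\<close> is attached: its predecessor is
      nearer to the centre, hence already in \<open>W\<close>.\<close>
    from ex_has_least_nat[of "\<lambda>w. w \<in> V - W", OF this, of "gdist V E ends c"]
    obtain w where w: "w \<in> V - W" "\<And>y. y \<in> V - W \<Longrightarrow> gdist V E ends c w \<le> gdist V E ends c y"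
      by blast
    then have "w \<noteq> c" using less.prems(1) by blast
    with gdist_predecessor[OF G c(1), of w] w(1) obtain u where
      u: "u \<in> V" "gadj E ends u w" "gdist V E ends c u < gdist V E ends c w" by blast
    then have "u \<in> W" using w(2)[of u] by fastforce
    from less.prems(6)[OF this] obtain k where k: "(u, k) \<in> U" "Suc r \<le> k + gdist V E ends c u"
      by blast
    with u(3) c(2)[of w] w(1) obtain j where j: "k = Suc j" by (cases k) auto
    from u(2) obtain e where e: "e \<in> E" "ends e = (u, w) \<or> ends e = (w, u)"
      unfolding gadj_def by blast
    have "e \<notin> fst ` set L" 
      using less.prems(5)[of e] e(2) w(1) by (metis DiffD2 fst_conv snd_conv)
    with e(1) have "e \<in> E - fst ` set L" by blast
    from dfs_layout_insert_distinct[OF less.prems(3,4) _ this e(2), of j] k(1) j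
    obtain L' U' where L': "dfs_layout E ends (Suc r) c L' U'" "distinct (map fst L')"
      "fst ` set L' = insert e (fst ` set L)" "insert (w, j) U \<subseteq> U'" by blast
    have fin: "finite V" using G(1) by (simp add: is_graph_def)
    show ?thesis
    proof (rule less.hyps[of "insert w W" L' U'])
      show "card (V - insert w W) < card (V - W)"
        using w(1) fin by (intro psubset_card_mono) auto
      show "fst (ends e') \<in> insert w W \<and> snd (ends e') \<in> insert w W" if "e' \<in> fst ` set L'" for e'
        using that less.prems(5)[of e'] e(2) \<open>u \<in> W\<close> unfolding L'(3) by auto
      show "\<exists>k. (x, k) \<in> U' \<and> Suc r \<le> k + gdist V E ends c x" if "x \<in> insert w W" for x
      proof (cases "x = w")
        case True
        \<comment> \<open>The loss of one unit of depth is balanced by a distance larger by at least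
          one.\<close>
        with L'(4) k(2) j u(3) show ?thesis by (intro exI[of _ j]) auto
      next
        case False
        with less.prems(6)[of x] that L'(4) show ?thesis by blast
      qed
    qed (use less.prems w(1) L' in auto)
  qed
qed

text \<open>Each remaining edge hangs at its first endpoint. Entries of \<open>U\<close> are never
  lost, so that vertex can carry it after any number of insertions.\<close>

lemma dfs_layout_complete:
  assumes "finite D" "D \<subseteq> E - fst ` set L" "dfs_layout E ends d v L U" "distinct (map fst L)"
    "\<And>e. e \<in> E \<Longrightarrow> \<exists>k. (fst (ends e), Suc k) \<in> U"
  shows "\<exists>L' U'. dfs_layout E ends d v L' U' \<and> distinct (map fst L') \<and>
    fst ` set L' = fst ` set L \<union> D \<and> U \<subseteq> U'"
  using assms(1,2)
proof (induction D rule: finite_induct)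
  case empty
  with assms(3,4) show ?case by auto
next
  case (insert e D)
  then obtain L' U' where L': "dfs_layout E ends d v L' U'" "distinct (map fst L')"
    "fst ` set L' = fst ` set L \<union> D" "U \<subseteq> U'" by auto
  obtain k where "(fst (ends e), Suc k) \<in> U'" using assms(5)[of e] insert.prems L'(4) by blast
  moreover have "e \<in> E - fst ` set L'" using insert L'(3) by auto
  moreover have "ends e = (fst (ends e), snd (ends e)) \<or> ends e = (snd (ends e), fst (ends e))"
    by simp
  ultimately obtain L'' U'' where "dfs_layout E ends d v L'' U''" "distinct (map fst L'')"
    "fst ` set L'' = insert e (fst ` set L')" "insert (snd (ends e), k) U' \<subseteq> U''"
    using dfs_layout_insert_distinct[OF L'(1,2)] by metis
  with L'(3,4) show ?case by (intro exI[of _ L''] exI[of _ U'']) auto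
qed

text \<open>The breadth-first tree uses depth at most \<open>?r\<close>; the last unit is kept for
  the edges hung on afterwards.\<close>

lemma exists_dfs_layout:
  assumes G: "is_graph V E ends" "graph_connected V E ends"
  obtains c L U where "dfs_layout E ends (Suc (graph_radius V E ends)) c L U"
    "distinct (map fst L)" "fst ` set L = E"
proof -
  let ?r = "graph_radius V E ends"
  obtain c where c: "c \<in> V" "\<And>w. w \<in> V \<Longrightarrow> gdist V E ends c w \<le> ?r"
    using graph_centre[OF G] by blast
  have "\<exists>L U. dfs_layout E ends (Suc ?r) c L U \<and> distinct (map fst L) \<and>
      (\<forall>x\<in>V. \<exists>k. (x, Suc k) \<in> U)"
    by (rule breadth_first_layout[OF G c, of "{c}" "[]" "{(c, Suc ?r)}"])
      (use c(1) in \<open>auto intro: dfs_layout.intros\<close>)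
  then obtain L U where L: "dfs_layout E ends (Suc ?r) c L U" "distinct (map fst L)"
    "\<And>x. x \<in> V \<Longrightarrow> \<exists>k. (x, Suc k) \<in> U" by blast
  have "finite (E - fst ` set L)" using G(1) by (simp add: is_graph_def)
  moreover have "\<exists>k. (fst (ends e), Suc k) \<in> U" if "e \<in> E" for e
    using L(3) G(1) that by (auto simp: is_graph_def)
  ultimately obtain L' U' where L': "dfs_layout E ends (Suc ?r) c L' U'" "distinct (map fst L')"
    "fst ` set L' = fst ` set L \<union> (E - fst ` set L)"
    using dfs_layout_complete[OF _ subset_refl L(1,2)] by metis
  with dfs_layout_edges[OF L(1)] show thesis by (intro that[of c L' U']) auto
qed

section \<open>Valuations along a layout\<close>

primrec pos :: "('e \<times> bool) list \<Rightarrow> 'e \<Rightarrow> real \<Rightarrow> real" where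
  "pos [] e x = 0"
| "pos (a # L) e x = (if fst a = e then orient (snd a) x else 1 + pos L e x)"

text \<open>Affineness gives continuity, and the nonzero slope gives finite fibres.\<close>

lemma pos_affine: "\<exists>k c. pos L e = (\<lambda>x. k + c * x) \<and> (e \<in> fst ` set L \<longrightarrow> c \<noteq> 0)"
proof (induction L)
  case Nil
  show ?case by (intro exI[of _ 0]) auto
next
  case (Cons a L)
  show ?case
  proof (cases "fst a = e")
    case True
    then show ?thesis
      by (intro exI[of _ "if snd a then 0 else 1"] exI[of _ "if snd a then 1 else - 1"])
        (auto simp: fun_eq_iff orient_def)
  next
    case False
    from Cons obtain k c where "pos L e = (\<lambda>x. k + c * x)" "e \<in> fst ` set L \<longrightarrow> c \<noteq> 0" by blast
    with False show ?thesis
      by (intro exI[of _ "1 + k"] exI[of _ c]) (auto simp: fun_eq_iff)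
  qed
qed

lemma continuous_on_pos: "continuous_on A (pos L e)"
proof -
  from pos_affine[of L e] obtain k c where *: "pos L e = (\<lambda>x. k + c * x)" by blast
  show ?thesis unfolding * by (intro continuous_intros)
qed

lemma finite_pos_fibre:
  assumes "e \<in> fst ` set L"
  shows "finite {x. pos L e x = y}"
proof -
  from pos_affine[of L e] assms obtain k c where *: "pos L e = (\<lambda>x. k + c * x)" "c \<noteq> 0" by blast
  then have "{x. pos L e x = y} \<subseteq> {(y - k) / c}" by auto
  then show ?thesis by (rule finite_subset) simp
qed

lemma pos_bounds:
  "e \<in> fst ` set L \<Longrightarrow> 0 < x \<Longrightarrow> x < 1 \<Longrightarrow> 0 \<le> pos L e x \<and> pos L e x \<le> real (length L)"
proof (induction L)
  case (Cons a L)
  then show ?case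
    by (cases "fst a = e") (auto simp: orient_def)
qed simp

lemma Ep_eq_edge_pt:
  "0 < x \<Longrightarrow> x < 1 \<Longrightarrow> Ep e x = edge_pt ends a y \<longleftrightarrow> e = fst a \<and> y = orient (snd a) x"
  by (cases "snd a") (auto simp: edge_pt_def cq_def orient_def)

text \<open>An interior point of an edge occurs once along a list of distinct edges, so its position
  decides membership. A vertex may occur many times.\<close>

lemma Ep_in_seg_iff:
  assumes "distinct (map fst L)" "0 < x" "x < 1"
  shows "Ep e x \<in> seg ends L p q \<longleftrightarrow> e \<in> fst ` set L \<and> p \<le> pos L e x \<and> pos L e x \<le> q"
  using assms(1)
proof (induction L arbitrary: p q)
  case (Cons a L)
  have "Ep e x \<in> edge_pt ends a ` {max 0 p..min 1 q} \<longleftrightarrow>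
      e = fst a \<and> p \<le> orient (snd a) x \<and> orient (snd a) x \<le> q"
    using assms(2,3) by (auto simp: image_iff Ep_eq_edge_pt orient_def)
  moreover have "Ep e x \<in> seg ends L (p - 1) (q - 1) \<longleftrightarrow>
      e \<in> fst ` set L \<and> p \<le> 1 + pos L e x \<and> 1 + pos L e x \<le> q"
    using Cons by (auto simp: algebra_simps)
  moreover have "fst a \<notin> fst ` set L" using Cons.prems by (auto simp: image_iff)
  ultimately show ?case by auto
qed simp

lemma Ep_in_cake_iff: "Ep e x \<in> cake_pts E ends \<longleftrightarrow> e \<in> E \<and> 0 < x \<and> x < 1"
proof
  show "Ep e x \<in> cake_pts E ends \<Longrightarrow> e \<in> E \<and> 0 < x \<and> x < 1"
    by (auto simp: cake_pts_def cq_def less_le split: if_splits)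
  show "e \<in> E \<and> 0 < x \<and> x < 1 \<Longrightarrow> Ep e x \<in> cake_pts E ends"
    by (auto simp: cake_pts_def cq_def image_iff intro!: bexI[of _ "(e, x)"])
qed

section \<open>Finite sets, open sets and measurability\<close>

lemma finite_vertices_of_cake: "finite E \<Longrightarrow> finite (cake_pts E ends \<inter> range Vx)"
  by (rule finite_subset[of _ "Vx ` (fst ` ends ` E \<union> snd ` ends ` E)"])
    (auto simp: cake_pts_def cq_def split: if_splits)

text \<open>Only ends of edges map to a vertex, so the preimage of a finite set is finite, hence
  closed in a Hausdorff space. This makes singletons measurable; \<open>emeasure\<close> is 0 on
  non-measurable sets by default, so value 0 alone would not give a null set.\<close>

lemma closedin_cake_finite:
  assumes "finite E" "finite F" "F \<subseteq> cake_pts E ends"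
  shows "closedin (cake_top E ends) F"
proof -
  have "finite {p \<in> E \<times> {0..1}. cq ends p = z}" for z
  proof (cases z)
    case (Vx v)
    have "{p \<in> E \<times> {0..1}. cq ends p = z} \<subseteq> E \<times> {0, 1}"
      by (auto simp: Vx cq_def split: if_splits)
    then show ?thesis by (rule finite_subset) (use assms(1) in simp)
  next
    case (Ep e x)
    have "{p \<in> E \<times> {0..1}. cq ends p = z} \<subseteq> {(e, x)}"
      by (auto simp: Ep cq_def split: if_splits)
    then show ?thesis by (rule finite_subset) simp
  qed
  then have "finite (\<Union>z\<in>F. {p \<in> E \<times> {0..1}. cq ends p = z})" using assms(2) by simp
  moreover have "Hausdorff_space (edges_top E)"
    unfolding edges_top_def Hausdorff_space_prod_topology
    by (auto simp: Hausdorff_space_subtopology)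
  ultimately have "closedin (edges_top E) (\<Union>z\<in>F. {p \<in> E \<times> {0..1}. cq ends p = z})"
    by (intro closedin_Hausdorff_finite) auto
  moreover have "topspace (edges_top E) - (\<Union>z\<in>F. {p \<in> E \<times> {0..1}. cq ends p = z})
      = {p \<in> E \<times> {0..1}. cq ends p \<in> cake_pts E ends - F}"
    by (auto simp: cake_pts_def)
  ultimately show ?thesis
    using assms(3) by (auto simp: closedin_def openin_cake_top)
qed

lemma openin_cake_Ep:
  assumes "\<And>e. e \<in> E \<Longrightarrow> open (T e)"
  shows "openin (cake_top E ends) {Ep e x |e x. e \<in> E \<and> 0 < x \<and> x < 1 \<and> x \<in> T e}"
proof -
  have "openin (edges_top E) (\<Union>e\<in>E. {e} \<times> (T e \<inter> {0<..<1}))"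
  proof (intro openin_Union ballI, clarsimp)
    fix e assume "e \<in> E"
    with assms have "open (T e \<inter> {0<..<1})" by auto
    then have "openin (top_of_set {0..1}) ({0..1} \<inter> (T e \<inter> {0<..<1}))"
      by (rule openin_open_Int)
    moreover have "{0..1} \<inter> (T e \<inter> {0<..<1}) = T e \<inter> {0<..<1}" by auto
    ultimately show "openin (edges_top E) ({e} \<times> (T e \<inter> {0<..<1}))"
      using \<open>e \<in> E\<close> by (simp add: edges_top_def openin_prod_Times_iff)
  qed
  moreover have "{p \<in> E \<times> {0..1}. cq ends p \<in> {Ep e x |e x. e \<in> E \<and> 0 < x \<and> x < 1 \<and> x \<in> T e}}
      = (\<Union>e\<in>E. {e} \<times> (T e \<inter> {0<..<1}))"
    by (auto simp: cq_def split: if_splits)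
  ultimately show ?thesis
    by (auto simp: openin_cake_top Ep_in_cake_iff)
qed

text \<open>The vertices form a null set, so the value \<open>0\<close> given to them is immaterial.\<close>

definition coord :: "('e \<times> bool) list \<Rightarrow> ('v, 'e) cpt \<Rightarrow> real" where
  "coord L z = (case z of Vx v \<Rightarrow> 0 | Ep e x \<Rightarrow> pos L e x)"

context
  fixes E :: "'e set" and ends :: "'e \<Rightarrow> 'v \<times> 'v" and \<mu> :: "('v, 'e) cpt measure"
  assumes fin: "finite E" and val: "is_valuation E ends \<mu>"
begin

interpretation prob_space \<mu>
  using val by (simp add: is_valuation_def)

lemma sets_valuation: "openin (cake_top E ends) U \<Longrightarrow> U \<in> sets \<mu>"
proof -
  assume U: "openin (cake_top E ends) U"
  have "{U. openin (cake_top E ends) U} \<subseteq> Pow (topspace (cake_top E ends))"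
    by (auto dest: openin_subset[THEN subsetD])
  then have "sets \<mu> = sigma_sets (topspace (cake_top E ends)) {U. openin (cake_top E ends) U}"
    using val by (simp add: is_valuation_def cake_borel_def)
  then show ?thesis using U by (auto intro: sigma_sets.Basic)
qed

lemma space_valuation: "space \<mu> = cake_pts E ends"
proof -
  have "{U. openin (cake_top E ends) U} \<subseteq> Pow (topspace (cake_top E ends))"
    by (auto dest: openin_subset[THEN subsetD])
  moreover have "space \<mu> = space (cake_borel E ends)"
    using val by (intro sets_eq_imp_space_eq) (simp add: is_valuation_def)
  ultimately show ?thesis by (simp add: cake_borel_def space_measure_of)
qed

lemma finite_null_valuation:
  assumes "finite F" "F \<subseteq> cake_pts E ends"
  shows "F \<in> null_sets \<mu>"
proof -
  have "{x} \<in> null_sets \<mu>" if "x \<in> F" for x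
  proof -
    have "openin (cake_top E ends) (cake_pts E ends - {x})"
      using closedin_cake_finite[OF fin, of "{x}" ends] that assms(2) by (auto simp: closedin_def)
    then have "space \<mu> - (cake_pts E ends - {x}) \<in> sets \<mu>" by (intro sets.compl_sets sets_valuation)
    moreover have "space \<mu> - (cake_pts E ends - {x}) = {x}"
      using that assms(2) by (auto simp: space_valuation)
    ultimately show ?thesis using val by (auto simp: is_valuation_def null_sets_def)
  qed
  then have "(\<Union>x\<in>F. {x}) \<in> null_sets \<mu>" using assms(1) by (intro null_sets_UN') (auto intro: countable_finite)
  then show ?thesis by simp
qed

lemma measure_division:
  assumes "\<alpha> \<in> sets \<mu>" "\<alpha> \<union> \<beta> = cake_pts E ends" "finite (\<alpha> \<inter> \<beta>)"
  shows "measure \<mu> \<beta> = 1 - measure \<mu> \<alpha>"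
proof -
  have "\<alpha> \<inter> \<beta> \<in> null_sets \<mu>" using assms by (intro finite_null_valuation) auto
  then have "measure \<mu> ((space \<mu> - \<alpha>) \<union> (\<alpha> \<inter> \<beta>)) = measure \<mu> (space \<mu> - \<alpha>)"
    using assms(1) by (intro measure_Un_null_set) auto
  moreover have "(space \<mu> - \<alpha>) \<union> (\<alpha> \<inter> \<beta>) = \<beta>" using assms(2) by (auto simp: space_valuation)
  ultimately show ?thesis using prob_compl[OF assms(1)] by simp
qed

text \<open>\<open>coord\<close> need not be continuous at vertices, so a preimage is split into an
  open set of interior points and a null set of vertices.\<close>

lemma measurable_coord: "coord L \<in> borel_measurable \<mu>"
proof (rule borel_measurableI)
  fix S :: "real set" assume "open S"
  then have "open (pos L e -` S)" for e
    using continuous_on_pos by (intro open_vimage) auto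
  then have "openin (cake_top E ends) {Ep e x |e x. e \<in> E \<and> 0 < x \<and> x < 1 \<and> x \<in> pos L e -` S}"
    by (intro openin_cake_Ep)
  moreover have "(if 0 \<in> S then cake_pts E ends \<inter> range Vx else {}) \<in> null_sets \<mu>"
    using finite_null_valuation finite_vertices_of_cake[OF fin] by auto
  ultimately have "{Ep e x |e x. e \<in> E \<and> 0 < x \<and> x < 1 \<and> x \<in> pos L e -` S} \<union>
      (if 0 \<in> S then cake_pts E ends \<inter> range Vx else {}) \<in> sets \<mu>"
    by (intro sets.Un sets_valuation null_setsD2)
  moreover have "coord L -` S \<inter> space \<mu> = {Ep e x |e x. e \<in> E \<and> 0 < x \<and> x < 1 \<and> x \<in> pos L e -` S} \<union>
      (if 0 \<in> S then cake_pts E ends \<inter> range Vx else {})"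
    unfolding space_valuation
    by (rule set_eqI, case_tac x) (auto simp: coord_def Ep_in_cake_iff)
  ultimately show "coord L -` S \<inter> space \<mu> \<in> sets \<mu>" by simp
qed

lemma finite_coord_fibre:
  assumes "fst ` set L = E"
  shows "finite {z \<in> cake_pts E ends. coord L z = y}"
proof (rule finite_subset)
  show "{z \<in> cake_pts E ends. coord L z = y} \<subseteq>
      (cake_pts E ends \<inter> range Vx) \<union> (\<Union>e\<in>E. Ep e ` {x. pos L e x = y})"
    by (rule subsetI, case_tac x) (auto simp: coord_def Ep_in_cake_iff)
  show "finite ((cake_pts E ends \<inter> range Vx) \<union> (\<Union>e\<in>E. Ep e ` {x. pos L e x = y}))"
    using fin assms
    by (intro finite_UnI finite_vertices_of_cake finite_UN_I finite_imageI finite_pos_fibre) simp_all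
qed

text \<open>\<open>F\<close> is the distribution function of the image of the valuation under
  \<open>coord\<close>. Fibres of \<open>coord\<close> are finite, so the image has no atoms and
  \<open>F\<close> is continuous. Vertices are null, so \<open>S\<close> may differ from the segment
  by them.\<close>

lemma valuation_of_seg:
  assumes L: "distinct (map fst L)" "fst ` set L = E"
  obtains F where "continuous_on UNIV F" "mono F" "F 0 = (0::real)" "F (real (length L)) = 1"
    "\<And>p q S. p \<le> q \<Longrightarrow> seg ends L p q \<subseteq> S \<Longrightarrow> S \<subseteq> seg ends L p q \<union> range Vx \<Longrightarrow>
       S \<subseteq> cake_pts E ends \<Longrightarrow> S \<in> sets \<mu> \<and> measure \<mu> S = F q - F p"
proof -
  define N where "N = distr \<mu> borel (coord L)"
  interpret N: real_distribution N
    unfolding N_def using measurable_coord by (intro real_distribution_distr)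
  have N: "measure N B = measure \<mu> (coord L -` B \<inter> cake_pts E ends)" if "B \<in> sets borel" for B
    unfolding N_def using that measurable_coord by (subst measure_distr) (auto simp: space_valuation)
  have null: "measure N {y} = 0" for y
  proof -
    have "coord L -` {y} \<inter> cake_pts E ends = {z \<in> cake_pts E ends. coord L z = y}" by auto
    then show ?thesis
      using finite_null_valuation[OF finite_coord_fibre[OF L(2), of y]]
      by (simp add: N measure_eq_0_null_sets)
  qed
  have vnull: "A \<in> null_sets \<mu>" if "A \<subseteq> cake_pts E ends \<inter> range Vx" for A
    using that finite_subset[OF that finite_vertices_of_cake[OF fin]]
    by (intro finite_null_valuation) auto
  have coord_bounds: "0 \<le> coord L z \<and> coord L z \<le> real (length L)" if "z \<in> cake_pts E ends" for z
    using that pos_bounds[of _ L] L(2) by (cases z) (auto simp: coord_def Ep_in_cake_iff)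
  show thesis
  proof
    show "continuous_on UNIV (cdf N)"
      using N.isCont_cdf null by (auto simp: continuous_on_eq_continuous_at)
    show "mono (cdf N)" using N.cdf_nondecreasing by (auto simp: mono_def)
    have "coord L -` {..0} \<inter> cake_pts E ends = coord L -` {0} \<inter> cake_pts E ends"
      using coord_bounds by force
    then show "cdf N 0 = 0" using null[of 0] by (simp add: cdf_def N)
    have "coord L -` {..real (length L)} \<inter> cake_pts E ends = space \<mu>"
      using coord_bounds by (auto simp: space_valuation)
    then show "cdf N (real (length L)) = 1" by (simp add: cdf_def N prob_space)
  next
    fix p q :: real and S
    assume pq: "p \<le> q" and S: "seg ends L p q \<subseteq> S" "S \<subseteq> seg ends L p q \<union> range Vx"
      "S \<subseteq> cake_pts E ends"
    let ?A = "coord L -` {p..q} \<inter> cake_pts E ends"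
    have A: "?A \<in> sets \<mu>"
      using measurable_sets[OF measurable_coord, of "{p..q}" L] by (simp add: space_valuation)
    have iff: "Ep e x \<in> S \<longleftrightarrow> Ep e x \<in> ?A" if "Ep e x \<in> cake_pts E ends" for e x
    proof -
      from that have "e \<in> E" "0 < x" "x < 1" by (auto simp: Ep_in_cake_iff)
      then show ?thesis
        using S that Ep_in_seg_iff[OF L(1), of x e ends p q] L(2) by (auto simp: coord_def)
    qed
    have "z \<in> range Vx" if "z \<in> cake_pts E ends" "z \<in> S \<longleftrightarrow> z \<notin> ?A" for z
      using that iff by (cases z) blast+
    then have "S - ?A \<subseteq> cake_pts E ends \<inter> range Vx" "?A - S \<subseteq> cake_pts E ends \<inter> range Vx"
      using S(3) by blast+
    then have n: "S - ?A \<in> null_sets \<mu>" "?A - S \<in> null_sets \<mu>"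
      by (simp_all only: vnull)
    have eq: "(?A - (?A - S)) \<union> (S - ?A) = S" by blast
    have "(?A - (?A - S)) \<union> (S - ?A) \<in> sets \<mu>"
      by (rule sets.Un[OF sets.Diff[OF A null_setsD2[OF n(2)]] null_setsD2[OF n(1)]])
    then have Sm: "S \<in> sets \<mu>" unfolding eq .
    have "measure \<mu> ((?A - (?A - S)) \<union> (S - ?A)) = measure \<mu> ?A"
      using n A by (simp only: measure_Un_null_set measure_Diff_null_set sets.Diff null_setsD2)
    then have "measure \<mu> S = measure \<mu> ?A" unfolding eq .
    also have "\<dots> = measure N {p..q}" by (simp add: N)
    also have "\<dots> = cdf N q - cdf N p"
    proof (cases "p = q")
      case False
      have "{p..q} = {p} \<union> {p<..q}" using pq by auto
      then have "measure N {p..q} = measure N {p} + measure N {p<..q}"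
        using N.finite_measure_Union[of "{p}" "{p<..q}"] by simp
      with False pq show ?thesis using N.cdf_diff_eq[of p q] null by simp
    qed (simp add: null)
    finally show "S \<in> sets \<mu> \<and> measure \<mu> S = cdf N q - cdf N p" using Sm by simp
  qed
qed

end

section \<open>Consensus intervals\<close>

text \<open>Measuring the line by the average \<open>u\<close> of the two distribution functions makes the
  difference \<open>d\<close> a continuous function of \<open>u\<close> with \<open>d 0 = d 1 = 0\<close>, hence a periodic one; so \<open>d\<close>
  takes equal values at two points at distance \<open>t\<close> on the circle. If the arc between them passes
  through \<open>0\<close>, its complement is an interval of size \<open>1 - t\<close>.\<close>

lemma exists_equal_shift:
  fixes d :: "real \<Rightarrow> real"
  assumes d: "continuous_on {0..1} d" "d 0 = d 1" and t: "0 \<le> t" "t \<le> 1"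
  obtains u u' where "0 \<le> u" "u \<le> u'" "u' \<le> 1" "d u = d u'" "u' - u = t \<or> u' - u = 1 - t"
proof -
  \<comment> \<open>The periodic extension of \<open>d\<close>, which makes \<open>u + t\<close> an
    admissible argument.\<close>
  define h where "h u = (if u \<le> 1 then d u else d (u - 1))" for u
  have h: "continuous_on {0..2} h"
  proof -
    have "continuous_on ({0..1} \<union> {1..2}) h"
      unfolding h_def using d
      by (intro continuous_on_If continuous_on_compose2[OF d(1)] continuous_intros) auto
    moreover have "{0..1} \<union> {1..2} = {0..2::real}" by auto
    ultimately show ?thesis by simp
  qed
  define k where "k u = h (u + t) - h u" for u
  have k: "continuous_on {0..1} k"
    unfolding k_def using t by (intro continuous_intros continuous_on_compose2[OF h]) auto
  obtain a where a: "a \<in> {0..1}" "\<And>u. u \<in> {0..1} \<Longrightarrow> d u \<le> d a"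
    using continuous_attains_sup[OF _ _ d(1)] by auto
  obtain b where b: "b \<in> {0..1}" "\<And>u. u \<in> {0..1} \<Longrightarrow> d b \<le> d u"
    using continuous_attains_inf[OF _ _ d(1)] by auto
  \<comment> \<open>The shift difference is at most 0 at a maximum of \<open>d\<close> and at least
    0 at a minimum, so it vanishes somewhere.\<close>
  have "k a \<le> 0" using a(1) a(2)[of "a + t"] a(2)[of "a + t - 1"] t by (auto simp: k_def h_def)
  moreover have "0 \<le> k b"
    using b(1) b(2)[of "b + t"] b(2)[of "b + t - 1"] t by (auto simp: k_def h_def)
  moreover have "connected (k ` {0..1})"
    using k by (intro connected_continuous_image) auto
  ultimately have "0 \<in> k ` {0..1}"
    using a(1) b(1) connected_contains_Icc[of "k ` {0..1}" "k a" "k b"] by force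
  then obtain u where u: "0 \<le> u" "u \<le> 1" "k u = 0" by auto
  show thesis
  proof (cases "u + t \<le> 1")
    case True
    with u t show thesis by (intro that[of u "u + t"]) (auto simp: k_def h_def)
  next
    case False
    \<comment> \<open>Past 1 the shifted point wraps round to \<open>u + t - 1\<close>, below
      \<open>u\<close> at distance \<open>1 - t\<close>.\<close>
    with u t show thesis by (intro that[of "u + t - 1" u]) (auto simp: k_def h_def)
  qed
qed

lemma simultaneous_interval:
  fixes F G :: "real \<Rightarrow> real"
  assumes F: "continuous_on UNIV F" "mono F" "F 0 = 0" "F m = 1"
    and G: "continuous_on UNIV G" "mono G" "G 0 = 0" "G m = 1"
    and m: "0 \<le> m" and t: "0 \<le> t" "t \<le> 1"
  obtains p q s where "0 \<le> p" "p \<le> q" "q \<le> m" "s = t \<or> s = 1 - t" "F q - F p = s" "G q - G p = s"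
proof -
  define A where "A x = (F x + G x) / 2" for x
  have A: "continuous_on {0..m} A" unfolding A_def
    using F(1) G(1) by (intro continuous_intros) (auto intro: continuous_on_subset)
  have "\<exists>x. 0 \<le> x \<and> x \<le> m \<and> A x = u" if "0 \<le> u" "u \<le> 1" for u
    using IVT'[of A 0 u m] that A m F G by (auto simp: A_def)
  then obtain x where x: "\<And>u. 0 \<le> u \<Longrightarrow> u \<le> 1 \<Longrightarrow> 0 \<le> x u \<and> x u \<le> m \<and> A (x u) = u" by metis
  define d where "d u = F (x u) - G (x u)" for u
  \<comment> \<open>The choice \<open>x\<close> need not be continuous or monotone. Since
    \<open>F\<close> and \<open>G\<close> both increase, their difference changes at most as much as
    their sum.\<close>
  have ineq: "\<bar>d u - d u'\<bar> \<le> 2 * \<bar>u - u'\<bar>" if "0 \<le> u" "u \<le> 1" "0 \<le> u'" "u' \<le> 1" for u u'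
  proof -
    have *: "\<bar>F a - G a - (F b - G b)\<bar> \<le> 2 * \<bar>A a - A b\<bar>" if "a \<le> b" for a b
      using monoD[OF F(2) that] monoD[OF G(2) that] by (auto simp: A_def field_simps abs_if)
    show ?thesis
      using *[of "x u" "x u'"] *[of "x u'" "x u"] x[of u] x[of u'] that
      by (cases "x u \<le> x u'") (auto simp: d_def abs_minus_commute)
  qed
  have "2-lipschitz_on {0..1} d"
    using ineq by (intro lipschitz_onI) (auto simp: dist_real_def)
  then have "continuous_on {0..1} d" by (rule lipschitz_on_continuous_on)
  moreover have "d 0 = d 1"
  proof -
    have "F (x 0) + G (x 0) = 0" "0 \<le> F (x 0)" "0 \<le> G (x 0)"
      using x[of 0] monoD[OF F(2), of 0 "x 0"] monoD[OF G(2), of 0 "x 0"] F G by (auto simp: A_def)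
    moreover have "F (x 1) + G (x 1) = 2" "F (x 1) \<le> 1" "G (x 1) \<le> 1"
      using x[of 1] monoD[OF F(2), of "x 1" m] monoD[OF G(2), of "x 1" m] F G by (auto simp: A_def)
    ultimately show ?thesis by (auto simp: d_def)
  qed
  ultimately obtain u u' where u: "0 \<le> u" "u \<le> u'" "u' \<le> 1" "d u = d u'" "u' - u = t \<or> u' - u = 1 - t"
    using exists_equal_shift t by metis
  have xu: "0 \<le> x u" "A (x u) = u" "x u' \<le> m" "A (x u') = u'" using x[of u] x[of u'] u by auto
  \<comment> \<open>The average grows by \<open>u' - u\<close> and the difference is unchanged, so
    each function grows by \<open>u' - u\<close>.\<close>
  have diff: "F (x u') - F (x u) = u' - u" "G (x u') - G (x u) = u' - u"
    using u(4) xu(2,4) by (auto simp: d_def A_def field_simps)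
  show thesis
  proof (cases "x u \<le> x u'")
    case True
    with xu diff u(5) show thesis by (intro that[of "x u" "x u'" "u' - u"]) auto
  next
    case False
    \<comment> \<open>Points in reverse order are possible only for size 0, where a degenerate
      interval serves.\<close>
    then have "F (x u') \<le> F (x u)" using F(2) by (auto simp: mono_def)
    with diff(1) u(2) have "u' - u = 0" by simp
    with xu diff u(5) x[of u] u(1,2,3) show thesis by (intro that[of "x u" "x u" 0]) auto
  qed
qed

section \<open>Assembling the division\<close>

lemma covered_components:
  assumes "covered (cake_top E ends) k (cake_pts E ends \<inter> range Vx) x S"
  obtains \<alpha> where "S \<subseteq> \<alpha>" "\<alpha> \<subseteq> S \<union> (cake_pts E ends \<inter> range Vx)" "\<alpha> \<subseteq> cake_pts E ends"
    "finite_components E ends \<alpha>" "n_components E ends \<alpha> \<le> k"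
proof -
  from assms obtain C where C: "finite C" "card C \<le> k" "\<And>K. K \<in> C \<Longrightarrow> path_connectedin (cake_top E ends) K"
    "S \<subseteq> \<Union>C" "\<Union>C \<subseteq> S \<union> (cake_pts E ends \<inter> range Vx)" unfolding covered_def by blast
  have "K \<subseteq> cake_pts E ends" if "K \<in> C" for K
    using path_connectedin_subset_topspace[OF C(3)[OF that]] by simp
  \<comment> \<open>The union of the covering sets is taken; it differs from \<open>S\<close> by
    vertices only.\<close>
  with path_components_of_Union_bound[OF C(1,3)] C(2,4,5) show thesis
    by (intro that[of "\<Union>C"]) (auto simp: finite_components_def n_components_def)
qed

lemma is_piece_up_to_vertices:
  assumes "finite E" "is_piece E ends S" "S \<subseteq> \<alpha>" "\<alpha> \<subseteq> S \<union> (cake_pts E ends \<inter> range Vx)"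
  shows "is_piece E ends \<alpha>"
proof -
  have "is_piece E ends (S \<union> (\<alpha> \<inter> (cake_pts E ends \<inter> range Vx)))"
    using finite_vertices_of_cake[OF assms(1)]
    by (intro is_piece_Un[OF assms(2)] is_piece_finite) auto
  moreover have "S \<union> (\<alpha> \<inter> (cake_pts E ends \<inter> range Vx)) = \<alpha>" using assms(3,4) by blast
  ultimately show ?thesis by simp
qed

theorem mainTheorem5:
  fixes V :: "'v set" and E :: "'e set" and ends :: "'e \<Rightarrow> 'v \<times> 'v"
    and vA vB :: "('v, 'e) cpt measure" and t :: real
  assumes "is_graph V E ends"
    and "graph_connected V E ends"
    and "is_valuation E ends vA"
    and "is_valuation E ends vB"
    and "0 \<le> t" and "t \<le> 1"
  shows "\<exists>\<alpha> \<beta>. is_division E ends \<alpha> \<beta> \<and> weighted_consensus vA vB t \<alpha> \<beta> \<and>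
           finite_components E ends \<alpha> \<and> finite_components E ends \<beta> \<and>
           n_components E ends \<alpha> \<le> graph_radius V E ends + 2 \<and>
           n_components E ends \<beta> \<le> graph_radius V E ends + 2"
proof -
  let ?k = "Suc (Suc (graph_radius V E ends))" and ?W = "cake_pts E ends \<inter> range Vx"
  have fin: "finite E" using assms(1) by (simp add: is_graph_def)
  obtain c L U where L: "dfs_layout E ends (Suc (graph_radius V E ends)) c L U"
    "distinct (map fst L)" "fst ` set L = E"
    using exists_dfs_layout[OF assms(1,2)] .
  \<comment> \<open>A probability space is nonempty, so there is an edge and the root belongs to the
    cake.\<close>
  have "cake_pts E ends \<noteq> {}"
    using prob_space.not_empty[of vA] assms(3) space_valuation[OF fin assms(3)]
    by (simp add: is_valuation_def)
  then have "L \<noteq> []" using L(3) by (auto simp: cake_pts_def)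
  with dfs_layout_root_in_cake[OF L(1)] have c: "Vx c \<in> ?W" by simp
  have ends: "Vx (fst (ends e)) \<in> ?W \<and> Vx (snd (ends e)) \<in> ?W" if "e \<in> E" for e
    using that edge_pt_in_cake[of "(e, True)" E 0 ends] edge_pt_in_cake[of "(e, True)" E 1 ends]
    by (simp add: edge_pt_def orient_def cq_def)
  let ?m = "real (length L)"
  obtain F where F: "continuous_on UNIV F" "mono F" "F 0 = (0::real)" "F ?m = 1"
    "\<And>p q S. p \<le> q \<Longrightarrow> seg ends L p q \<subseteq> S \<Longrightarrow> S \<subseteq> seg ends L p q \<union> range Vx \<Longrightarrow>
       S \<subseteq> cake_pts E ends \<Longrightarrow> S \<in> sets vA \<and> measure vA S = F q - F p"
    by (rule valuation_of_seg[OF fin assms(3) L(2,3)]) (rule that)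
  obtain G where G: "continuous_on UNIV G" "mono G" "G 0 = (0::real)" "G ?m = 1"
    "\<And>p q S. p \<le> q \<Longrightarrow> seg ends L p q \<subseteq> S \<Longrightarrow> S \<subseteq> seg ends L p q \<union> range Vx \<Longrightarrow>
       S \<subseteq> cake_pts E ends \<Longrightarrow> S \<in> sets vB \<and> measure vB S = G q - G p"
    by (rule valuation_of_seg[OF fin assms(4) L(2,3)]) (rule that)
  obtain p q s where pq: "0 \<le> p" "p \<le> q" "q \<le> ?m" and s: "s = t \<or> s = 1 - t"
    and FG: "F q - F p = s" "G q - G p = s"
    using simultaneous_interval[OF F(1-4) G(1-4) _ assms(5,6)] by (metis of_nat_0_le_iff)
  \<comment> \<open>The depth exceeds the radius by one, and \<open>covered_seg\<close> adds one
    more.\<close>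
  have cov: "covered (cake_top E ends) ?k ?W (Vx c) (seg ends L p q)" for p q
    using c ends by (intro covered_seg[OF L(1)]) auto
  obtain \<alpha> where \<alpha>: "seg ends L p q \<subseteq> \<alpha>" "\<alpha> \<subseteq> seg ends L p q \<union> ?W" "\<alpha> \<subseteq> cake_pts E ends"
    "finite_components E ends \<alpha>" "n_components E ends \<alpha> \<le> ?k"
    using covered_components[OF cov] .
  \<comment> \<open>The initial interval together with \<open>Vx c\<close> is connected, so it
    merges at the root with the cover of the final interval at no cost.\<close>
  let ?R = "seg ends L q ?m \<union> insert (Vx c) (seg ends L 0 p)"
  have "path_connectedin (cake_top E ends) (insert (Vx c) (seg ends L 0 p))"
    using c by (intro path_connected_initial_seg[OF L(1)]) auto
  then have covR: "covered (cake_top E ends) ?k ?W (Vx c) ?R"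
    by (rule covered_merge[OF cov]) auto
  obtain \<beta> where \<beta>: "?R \<subseteq> \<beta>" "\<beta> \<subseteq> ?R \<union> ?W" "\<beta> \<subseteq> cake_pts E ends"
    "finite_components E ends \<beta>" "n_components E ends \<beta> \<le> ?k"
    using covered_components[OF covR] .
  have "seg ends L 0 p \<union> seg ends L p q \<union> seg ends L q ?m = cake_pts E ends"
    using pq L(3) by (simp add: seg_Un seg_full)
  moreover have "seg ends L q ?m \<subseteq> \<beta>" "seg ends L 0 p \<subseteq> \<beta>" using \<beta>(1) by simp_all
  ultimately have un: "\<alpha> \<union> \<beta> = cake_pts E ends" using \<alpha>(1,3) \<beta>(3) by blast
  have "\<alpha> \<inter> \<beta> \<subseteq> ?W \<union> (\<Union>e\<in>E. Ep e ` ({x. pos L e x = p} \<union> {x. pos L e x = q}))" (is "_ \<subseteq> ?X")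
  proof
    fix z assume z: "z \<in> \<alpha> \<inter> \<beta>"
    with \<alpha>(3) have cake: "z \<in> cake_pts E ends" by blast
    show "z \<in> ?X"
    proof (cases z)
      case (Ep e x)
      with cake have ex: "e \<in> E" "0 < x" "x < 1" by (auto simp: Ep_in_cake_iff)
      have "Ep e x \<in> seg ends L p q" "Ep e x \<in> seg ends L q ?m \<or> Ep e x \<in> seg ends L 0 p"
        using z \<alpha>(2) \<beta>(2) Ep by auto
      then have "pos L e x = p \<or> pos L e x = q"
        using ex by (auto simp: Ep_in_seg_iff[OF L(2)])
      with Ep ex(1) show ?thesis by auto
    qed (use cake in auto)
  qed
  moreover have "finite ?X"
    using fin L(3)
    by (intro finite_UnI finite_vertices_of_cake finite_UN_I finite_imageI finite_pos_fibre) simp_all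
  ultimately have int: "finite (\<alpha> \<inter> \<beta>)" by (rule finite_subset)
  have "is_piece E ends \<alpha>"
    using L(3) by (intro is_piece_up_to_vertices[OF fin _ \<alpha>(1,2)] is_piece_seg) simp
  moreover have "is_piece E ends \<beta>"
  proof (rule is_piece_up_to_vertices[OF fin _ \<beta>(1,2)])
    have "is_piece E ends (seg ends L q ?m \<union> ({Vx c} \<union> seg ends L 0 p))"
      using L(3) c by (intro is_piece_Un is_piece_seg is_piece_singleton) auto
    then show "is_piece E ends ?R" by simp
  qed
  ultimately have div: "is_division E ends \<alpha> \<beta>" "is_division E ends \<beta> \<alpha>"
    using un int by (auto simp: is_division_def Un_commute Int_commute)
  have "\<alpha> \<in> sets vA \<and> measure vA \<alpha> = s" "\<alpha> \<in> sets vB \<and> measure vB \<alpha> = s"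
    using F(5)[OF pq(2) \<alpha>(1) _ \<alpha>(3)] G(5)[OF pq(2) \<alpha>(1) _ \<alpha>(3)] \<alpha>(2) FG by auto
  moreover then have "measure vA \<beta> = 1 - s" "measure vB \<beta> = 1 - s"
    using measure_division[OF fin assms(3) _ un int] measure_division[OF fin assms(4) _ un int] by auto
  \<comment> \<open>If the interval has size \<open>1 - t\<close>, the two pieces exchange
    roles.\<close>
  ultimately have "s = t \<Longrightarrow> weighted_consensus vA vB t \<alpha> \<beta>"
    "s = 1 - t \<Longrightarrow> weighted_consensus vA vB t \<beta> \<alpha>"
    by (auto simp: weighted_consensus_def)
  with s div \<alpha>(4,5) \<beta>(4,5) show ?thesis
    by (metis add_2_eq_Suc')
qed

end
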